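(* Let $U\subseteq\mathbb{R}^2$ be open and, for integers $i,j\ge 0$, let $\mu_{i,j}(t,s)=-\mu_{j,i}(t,s)$ and $\beta_i(t,s)$ be real-valued smooth functions of $(t,s)\in U$. Set $Pf(i,j)=\mu_{i,j}$, $Pf(d_0,i)=\beta_i$, $Pf(d_1,i)=\frac{\partial}{\partial s}\beta_i$, $Pf(d_0,d_1)=0$, and assume $$\frac{\partial}{\partial t}Pf(d_0,i)=Pf(d_0,i+1),\qquad \frac{\partial}{\partial t}Pf(i,j)=Pf(i+1,j)+Pf(i,j+1),\qquad \frac{\partial}{\partial s}Pf(i,j)=Pf(d_0,d_1,i,j).$$ Define $$\tau_{2n}(t,s)=Pf(0,1,\dots,2n-1),\qquad \tau_{2n+1}(t,s)=Pf(d_0,0,1,\dots,2n),$$ and assume $\tau_n\ne 0$ on $U$ for all $n\ge 0$. Then $$u_n=\frac{\tau_{n+1}\tau_{n-1}}{\tau_n^2},\qquad b_n=\frac{\partial}{\partial s}\log\tau_n$$ satisfy the Toda lattice of BKP type in $2+1$ dimension: $$\frac{\partial}{\partial s}u_n=u_n(b_{n+1}-2b_n+b_{n-1}),\qquad \frac{\partial}{\partial t}b_n=u_n(b_{n-1}-b_{n+1}),\qquad n=1,2,\dots$$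
   Context: Hirota's Pfaffian notation: given symbols $a_1,\dots,a_{2N}$ and prescribed entries $Pf(a_i,a_j)=-Pf(a_j,a_i)$, $Pf(a_1,\dots,a_{2N})$ denotes the Pfaffian of the $2N\times 2N$ skew-symmetric matrix with $(i,j)$ entry $Pf(a_i,a_j)$; the empty Pfaffian is $1$ (so $\tau_0=1$). In particular $Pf(d_0,d_1,i,j)=-Pf(d_0,i)Pf(d_1,j)+Pf(d_0,j)Pf(d_1,i)$ since $Pf(d_0,d_1)=0$. Here $\frac{\partial}{\partial s}\log\tau_n$ means $(\partial_s\tau_n)/\tau_n$. *)

theory Defs
  imports "HOL-Analysis.Analysis"
begin

section \<open>Pfaffians\<close>

text \<open>
  The Pfaffian of the skew-symmetric matrix \<open>(A i j)\<close>, \<open>0 \<le> i, j < 2 * N\<close>, with rows and columns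
  numbered from 0.
\<close>
definition pfaffian :: "nat \<Rightarrow> (nat \<Rightarrow> nat \<Rightarrow> real) \<Rightarrow> real" where
  "pfaffian N A =
     (\<Sum>\<sigma> | \<sigma> permutes {..<2 * N}.
        of_int (sign \<sigma>) * (\<Prod>k<N. A (\<sigma> (2 * k)) (\<sigma> (2 * k + 1)))) / (2 ^ N * fact N)"

text \<open>
  Hirota's notation \<open>Pf(a\<^sub>1, \<dots>, a\<^sub>2\<^sub>N)\<close> for prescribed entries \<open>E a b = Pf(a, b)\<close>. It is only
  meaningful for lists of even length.
\<close>
definition hirota_Pf :: "('a \<Rightarrow> 'a \<Rightarrow> real) \<Rightarrow> 'a list \<Rightarrow> real" where
  "hirota_Pf E as = pfaffian (length as div 2) (\<lambda>i j. E (as ! i) (as ! j))"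


section \<open>Smooth functions\<close>

fun k_smooth_on :: "nat \<Rightarrow> 'a::real_normed_vector set \<Rightarrow> ('a \<Rightarrow> 'b::real_normed_vector) \<Rightarrow> bool" where
  "k_smooth_on 0 S f \<longleftrightarrow> continuous_on S f"
| "k_smooth_on (Suc k) S f \<longleftrightarrow>
     (\<forall>x\<in>S. f differentiable (at x)) \<and>
     (\<forall>v. k_smooth_on k S (\<lambda>x. frechet_derivative f (at x) v))"

text \<open>Being \<open>C\<^sup>\<infinity>\<close> on a set, which is meant to be open.\<close>
definition smooth_on :: "'a::real_normed_vector set \<Rightarrow> ('a \<Rightarrow> 'b::real_normed_vector) \<Rightarrow> bool" where
  "smooth_on S f \<longleftrightarrow> (\<forall>k. k_smooth_on k S f)"


section \<open>The tau functions\<close>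

text \<open>Points of the plane are pairs \<open>(t, s)\<close>.\<close>

definition partial_s :: "(real \<times> real \<Rightarrow> real) \<Rightarrow> real \<times> real \<Rightarrow> real" where
  "partial_s f p = deriv (\<lambda>y. f (fst p, y)) (snd p)"

text \<open>The symbols \<open>d\<^sub>0\<close>, \<open>d\<^sub>1\<close> and the integers \<open>i \<ge> 0\<close>.\<close>
datatype symb = D0 | D1 | Ix nat

fun bkp_entry ::
  "(nat \<Rightarrow> nat \<Rightarrow> real \<times> real \<Rightarrow> real) \<Rightarrow> (nat \<Rightarrow> real \<times> real \<Rightarrow> real) \<Rightarrow> real \<times> real
     \<Rightarrow> symb \<Rightarrow> symb \<Rightarrow> real"
where
  "bkp_entry \<mu> \<beta> p (Ix i) (Ix j) = \<mu> i j p"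
| "bkp_entry \<mu> \<beta> p D0 (Ix i) = \<beta> i p"
| "bkp_entry \<mu> \<beta> p (Ix i) D0 = - \<beta> i p"
| "bkp_entry \<mu> \<beta> p D1 (Ix i) = partial_s (\<beta> i) p"
| "bkp_entry \<mu> \<beta> p (Ix i) D1 = - partial_s (\<beta> i) p"
| "bkp_entry \<mu> \<beta> p D0 D0 = 0"
| "bkp_entry \<mu> \<beta> p D0 D1 = 0"
| "bkp_entry \<mu> \<beta> p D1 D0 = 0"
| "bkp_entry \<mu> \<beta> p D1 D1 = 0"

abbreviation bkp_Pf ::
  "(nat \<Rightarrow> nat \<Rightarrow> real \<times> real \<Rightarrow> real) \<Rightarrow> (nat \<Rightarrow> real \<times> real \<Rightarrow> real) \<Rightarrow> real \<times> real
     \<Rightarrow> symb list \<Rightarrow> real"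
where
  "bkp_Pf \<mu> \<beta> p \<equiv> hirota_Pf (bkp_entry \<mu> \<beta> p)"

definition tau ::
  "(nat \<Rightarrow> nat \<Rightarrow> real \<times> real \<Rightarrow> real) \<Rightarrow> (nat \<Rightarrow> real \<times> real \<Rightarrow> real) \<Rightarrow> nat
     \<Rightarrow> real \<times> real \<Rightarrow> real"
where
  "tau \<mu> \<beta> n p =
     (if even n then bkp_Pf \<mu> \<beta> p (map Ix [0..<n])
      else bkp_Pf \<mu> \<beta> p (D0 # map Ix [0..<n]))"

text \<open>Only used for \<open>n \<ge> 1\<close>, where the subtraction does not truncate.\<close>
definition toda_u ::
  "(nat \<Rightarrow> nat \<Rightarrow> real \<times> real \<Rightarrow> real) \<Rightarrow> (nat \<Rightarrow> real \<times> real \<Rightarrow> real) \<Rightarrow> nat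
     \<Rightarrow> real \<times> real \<Rightarrow> real"
where
  "toda_u \<mu> \<beta> n p = tau \<mu> \<beta> (n + 1) p * tau \<mu> \<beta> (n - 1) p / (tau \<mu> \<beta> n p)\<^sup>2"

text \<open>The logarithmic derivative \<open>\<partial>\<^sub>s log \<tau>\<^sub>n\<close>, read as \<open>(\<partial>\<^sub>s \<tau>\<^sub>n) / \<tau>\<^sub>n\<close> since \<open>\<tau>\<^sub>n\<close> may be negative.\<close>
definition toda_b ::
  "(nat \<Rightarrow> nat \<Rightarrow> real \<times> real \<Rightarrow> real) \<Rightarrow> (nat \<Rightarrow> real \<times> real \<Rightarrow> real) \<Rightarrow> nat
     \<Rightarrow> real \<times> real \<Rightarrow> real"
where
  "toda_b \<mu> \<beta> n p = partial_s (tau \<mu> \<beta> n) p / tau \<mu> \<beta> n p"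

end

theory Submission
  imports Defs
begin

text \<open>
  Expansion of Pfaffians along the first row gives the dressing rules
  \<open>\<partial>\<^sub>t Pf(\<dots>, m) = Pf(\<dots>, m + 1)\<close>, \<open>\<partial>\<^sub>s Pf(0, \<dots>) = Pf(d\<^sub>0, d\<^sub>1, 0, \<dots>)\<close> and
  \<open>\<partial>\<^sub>s Pf(d\<^sub>0, 0, \<dots>) = Pf(d\<^sub>1, 0, \<dots>)\<close>, where the entries \<open>Pf(d\<^sub>1, i)\<close> obey the same \<open>t\<close>-rule as
  \<open>Pf(d\<^sub>0, i)\<close> because the mixed partial derivatives of \<open>\<beta>\<^sub>i\<close> agree. The equation for \<open>u\<^sub>n\<close> is the
  logarithmic derivative of its definition. Multiplied by \<open>\<tau>\<^sub>n\<^sup>2\<close>, the equation for \<open>b\<^sub>n\<close> reads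
  \<open>\<tau>\<^sub>n \<partial>\<^sub>t\<partial>\<^sub>s\<tau>\<^sub>n - \<partial>\<^sub>t\<tau>\<^sub>n \<partial>\<^sub>s\<tau>\<^sub>n = \<tau>\<^sub>n\<^sub>+\<^sub>1 \<partial>\<^sub>s\<tau>\<^sub>n\<^sub>-\<^sub>1 - \<tau>\<^sub>n\<^sub>-\<^sub>1 \<partial>\<^sub>s\<tau>\<^sub>n\<^sub>+\<^sub>1\<close>, which for either parity of
  \<open>n\<close> is a Pluecker relation between Pfaffians.
\<close>


section \<open>First-row expansion\<close>

lemma pfaffian_permute:
  assumes p: "\<pi> permutes {..<2 * N}"
  shows "pfaffian N (\<lambda>i j. A (\<pi> i) (\<pi> j)) = of_int (sign \<pi>) * pfaffian N A"
proof -
  let ?P = "{\<sigma>. \<sigma> permutes {..<2 * N}}"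
  let ?g = "\<lambda>\<sigma>. of_int (sign \<sigma>) * (\<Prod>k<N. A (\<sigma> (2 * k)) (\<sigma> (2 * k + 1)))"
  have pp: "permutation \<sigma>" if "\<sigma> permutes {..<2*N}" for \<sigma>
    using that by (metis finite_lessThan permutes_imp_permutation)
  have "of_int (sign \<pi>) * sum ?g ?P = of_int (sign \<pi>) * (\<Sum>\<sigma>\<in>?P. ?g (\<pi> \<circ> \<sigma>))"
    using setum_permutations_compose_left[OF p, of ?g] by simp
  also have "\<dots> = (\<Sum>\<sigma>\<in>?P. of_int (sign \<sigma>) * (\<Prod>k<N. A (\<pi> (\<sigma> (2 * k))) (\<pi> (\<sigma> (2 * k + 1)))))"
    unfolding sum_distrib_left
  proof (rule sum.cong)
    fix \<sigma> assume "\<sigma> \<in> ?P"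
    then have "sign \<pi> * sign (\<pi> \<circ> \<sigma>) = sign \<sigma>"
      using pp p by (simp add: sign_compose)
    then have "of_int (sign \<pi>) * (of_int (sign (\<pi> \<circ> \<sigma>)) * x) = of_int (sign \<sigma>) * x" for x :: real
      by (metis mult.assoc of_int_mult)
    then show "of_int (sign \<pi>) * ?g (\<pi> \<circ> \<sigma>)
      = of_int (sign \<sigma>) * (\<Prod>k<N. A (\<pi> (\<sigma> (2 * k))) (\<pi> (\<sigma> (2 * k + 1))))"
      unfolding o_apply .
  qed simp
  finally show ?thesis
    unfolding pfaffian_def by simp
qed

text \<open>The permutations are grouped by the position \<open>b\<close> with
  \<open>\<sigma> b = a\<close>. Composing with \<open>h b\<close> on the right moves
  \<open>a\<close> from position \<open>b\<close> to position \<open>a\<close> without changing the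
  summand, so all \<open>card S\<close> groups have the same sum.\<close>

lemma sum_permutations_fix_value:
  fixes g :: "(nat \<Rightarrow> nat) \<Rightarrow> real"
  assumes S: "finite S" "a \<in> S"
    and h: "\<And>b. b \<in> S \<Longrightarrow> h b permutes S \<and> h b a = b"
    and inv: "\<And>b \<sigma>. b \<in> S \<Longrightarrow> \<sigma> permutes S \<Longrightarrow> g (\<sigma> \<circ> h b) = g \<sigma>"
  shows "(\<Sum>\<sigma> | \<sigma> permutes S. g \<sigma>) = card S * (\<Sum>\<sigma> | \<sigma> permutes S \<and> \<sigma> a = a. g \<sigma>)"
proof -
  let ?P = "{\<sigma>. \<sigma> permutes S}"
  have fin: "finite ?P" using S by (simp add: finite_permutations)
  have "(\<Sum>\<sigma>\<in>?P. g \<sigma>) = (\<Sum>b\<in>S. \<Sum>\<sigma>\<in>{\<sigma>\<in>?P. inv_into UNIV \<sigma> a = b}. g \<sigma>)"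
    by (rule sum.group[symmetric, OF fin S(1)])
      (use S(2) in \<open>auto simp: permutes_in_image[OF permutes_inv]\<close>)
  also have "\<dots> = (\<Sum>b\<in>S. \<Sum>\<sigma> | \<sigma> permutes S \<and> \<sigma> a = a. g \<sigma>)"
  proof (rule sum.cong[OF refl])
    fix b assume b: "b \<in> S"
    have hb: "h b permutes S" "h b a = b" using h b by auto
    show "(\<Sum>\<sigma>\<in>{\<sigma>\<in>?P. inv_into UNIV \<sigma> a = b}. g \<sigma>) = (\<Sum>\<sigma> | \<sigma> permutes S \<and> \<sigma> a = a. g \<sigma>)"
    proof (rule sum.reindex_bij_witness[where i = "\<lambda>\<sigma>. \<sigma> \<circ> inv (h b)" and j = "\<lambda>\<sigma>. \<sigma> \<circ> h b"])
      fix \<sigma> assume "\<sigma> \<in> {\<sigma>\<in>?P. inv_into UNIV \<sigma> a = b}"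
      then have s: "\<sigma> permutes S" "inv \<sigma> a = b" by auto
      then have "\<sigma> b = a" using permutes_inverses(1) by metis
      then show "\<sigma> \<circ> h b \<in> {\<sigma>. \<sigma> permutes S \<and> \<sigma> a = a}"
        using s hb by (auto intro: permutes_compose)
      show "\<sigma> \<circ> h b \<circ> inv (h b) = \<sigma>"
        using hb by (simp add: comp_assoc permutes_inv_o)
      show "g (\<sigma> \<circ> h b) = g \<sigma>" using inv b s by simp
    next
      fix \<sigma> assume "\<sigma> \<in> {\<sigma>. \<sigma> permutes S \<and> \<sigma> a = a}"
      then have s: "\<sigma> permutes S" "\<sigma> a = a" by auto
      show "\<sigma> \<circ> inv (h b) \<circ> h b = \<sigma>"
        using hb by (simp add: comp_assoc permutes_inv_o)
      have c: "\<sigma> \<circ> inv (h b) permutes S"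
        using s hb by (auto intro: permutes_compose permutes_inv)
      moreover have "(\<sigma> \<circ> inv (h b)) b = a"
        using hb s by (metis comp_apply permutes_inverses(2))
      ultimately show "\<sigma> \<circ> inv (h b) \<in> {\<sigma>\<in>?P. inv_into UNIV \<sigma> a = b}"
        using permutes_inv_eq by force
    qed
  qed
  finally show ?thesis by simp
qed

text \<open>The cycle that puts \<open>Suc j\<close> into position 1 and keeps the remaining indices
  in increasing order. Building it from \<open>j\<close> adjacent transpositions yields the sign of
  the \<open>j\<close>-th term of the first-row expansion.\<close>

fun row_cycle :: "nat \<Rightarrow> nat \<Rightarrow> nat" where
  "row_cycle 0 = id"
| "row_cycle (Suc j) = Transposition.transpose (Suc j) (Suc (Suc j)) \<circ> row_cycle j"

lemma row_cycle_apply: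
  "row_cycle j i = (if i = 1 then Suc j else if 2 \<le> i \<and> i \<le> Suc j then i - 1 else i)"
  by (induction j arbitrary: i) (auto simp: Transposition.transpose_def)

lemma row_cycle_permutes: "Suc j < n \<Longrightarrow> row_cycle j permutes {..<n}"
  by (induction j) (auto intro!: permutes_compose permutes_swap_id simp: permutes_id)

lemma sign_row_cycle: "sign (row_cycle j) = (- 1) ^ j"
proof (induction j)
  case (Suc j)
  have "permutation (row_cycle j)"
    using row_cycle_permutes[of j "Suc (Suc j)"] permutes_imp_permutation by blast
  then show ?case using Suc
    unfolding row_cycle.simps
    by (subst sign_compose) (simp_all add: permutation_swap_id sign_swap_id)
qed (simp add: sign_id)

text \<open>The summands of \<open>pfaffian\<close> are invariant under the permutations of the positions that preserve
  the pairs \<open>{2 * k, 2 * k + 1}\<close>, and these act transitively. So 0 may be assumed to be in position 0.\<close>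

lemma pfaffian_summand_pair_swap:
  fixes A :: "nat \<Rightarrow> nat \<Rightarrow> real"
  assumes "\<sigma> permutes {..<2 * Suc N}"
    and "A (\<sigma> 1) (\<sigma> 0) = - A (\<sigma> 0) (\<sigma> 1)"
  defines "g \<equiv> \<lambda>\<sigma>. of_int (sign \<sigma>) * (\<Prod>k<Suc N. A (\<sigma> (2 * k)) (\<sigma> (2 * k + 1)))"
  shows "g (\<sigma> \<circ> Transposition.transpose 0 1) = g \<sigma>"
proof -
  have "permutation \<sigma>" using assms(1) by (metis finite_lessThan permutes_imp_permutation)
  then have "sign (\<sigma> \<circ> Transposition.transpose 0 (1::nat)) = - sign \<sigma>"
    by (simp add: sign_compose permutation_swap_id sign_swap_id)
  then show ?thesis
    using assms(2) unfolding g_def prod.lessThan_Suc_shift by (simp add: Transposition.transpose_def)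
qed

text \<open>Exchanging the pair 0 with the pair \<open>m\<close> only permutes the factors of the
  product, and as a composition of two transpositions of the same kind it has sign 1.\<close>

lemma pfaffian_summand_block_swap:
  fixes A :: "nat \<Rightarrow> nat \<Rightarrow> real"
  assumes "\<sigma> permutes {..<2 * N}" and m: "m < N"
  defines "g \<equiv> \<lambda>\<sigma>. of_int (sign \<sigma>) * (\<Prod>k<N. A (\<sigma> (2 * k)) (\<sigma> (2 * k + 1)))"
    and "t \<equiv> Transposition.transpose 0 (2 * m) \<circ> Transposition.transpose 1 (2 * m + 1)"
  shows "g (\<sigma> \<circ> t) = g \<sigma>"
proof -
  have "permutation \<sigma>" using assms(1) by (metis finite_lessThan permutes_imp_permutation)
  moreover have "permutation t" "sign t = 1"
    unfolding t_def by (auto simp: sign_compose permutation_compose permutation_swap_id sign_swap_id)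
  ultimately have s: "sign (\<sigma> \<circ> t) = sign \<sigma>" by (simp add: sign_compose)
  have t0: "t (2 * k) = 2 * Transposition.transpose 0 m k" "t (2 * k + 1) = 2 * Transposition.transpose 0 m k + 1" for k
    unfolding t_def by (auto simp: Transposition.transpose_def; presburger)+
  have "(\<Prod>k<N. A (\<sigma> (t (2 * k))) (\<sigma> (t (2 * k + 1))))
     = (\<Prod>k<N. ((\<lambda>k. A (\<sigma> (2 * k)) (\<sigma> (2 * k + 1))) \<circ> Transposition.transpose 0 m) k)"
    unfolding t0 by simp
  also have "\<dots> = (\<Prod>k<N. A (\<sigma> (2 * k)) (\<sigma> (2 * k + 1)))"
    by (rule prod.permute[symmetric]) (use m in \<open>auto intro: permutes_swap_id\<close>)
  finally show ?thesis unfolding g_def s by simp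
qed

lemma permutes_insert_fixed_iff:
  assumes "a \<notin> S"
  shows "p permutes insert a S \<and> p a = a \<longleftrightarrow> p permutes S"
proof
  assume "p permutes insert a S \<and> p a = a"
  then show "p permutes S" by (auto intro: permutes_superset)
next
  assume "p permutes S"
  then show "p permutes insert a S \<and> p a = a"
    using assms by (auto intro: permutes_subset simp: permutes_not_in)
qed

text \<open>Composition with the inverse cycle on the left turns the condition
  \<open>\<sigma> 1 = Suc j\<close> into fixing 1. What remains permutes the numbers from 2 on, a
  copy of \<open>{..<2 * N}\<close> shifted by 2.\<close>

lemma sum_permutations_row_cycle:
  fixes g :: "(nat \<Rightarrow> nat) \<Rightarrow> real"
  assumes j: "j < 2 * N + 1"
  shows "(\<Sum>\<sigma> | \<sigma> permutes {..<2 * Suc N} \<and> \<sigma> 0 = 0 \<and> \<sigma> 1 = Suc j. g \<sigma>)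
    = (\<Sum>\<tau> | \<tau> permutes {..<2 * N}. g (row_cycle j \<circ> map_permutation {..<2 * N} ((+) 2) \<tau>))"
proof -
  let ?S = "{..<2 * Suc N}" and ?T = "{2..<2 * Suc N}" and ?c = "row_cycle j"
  have c: "?c permutes ?S" by (rule row_cycle_permutes) (use j in simp)
  have c01: "?c 0 = 0" "?c 1 = Suc j" "inv ?c 0 = 0" "inv ?c (Suc j) = 1"
    using permutes_inv_eq[OF c] by (auto simp: row_cycle_apply)
  have S: "?S = insert 0 (insert 1 ?T)" by auto
  have fixed: "{\<rho>. \<rho> permutes ?S \<and> \<rho> 0 = 0 \<and> \<rho> 1 = 1} = {\<rho>. \<rho> permutes ?T}"
    unfolding S using permutes_insert_fixed_iff[of 0 "insert 1 ?T"] permutes_insert_fixed_iff[of 1 ?T]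
    by auto
  have "(\<Sum>\<sigma> | \<sigma> permutes ?S \<and> \<sigma> 0 = 0 \<and> \<sigma> 1 = Suc j. g \<sigma>)
      = (\<Sum>\<rho> | \<rho> permutes ?S \<and> \<rho> 0 = 0 \<and> \<rho> 1 = 1. g (?c \<circ> \<rho>))"
    by (rule sum.reindex_bij_witness[where i = "\<lambda>\<rho>. ?c \<circ> \<rho>" and j = "\<lambda>\<sigma>. inv ?c \<circ> \<sigma>"])
      (use c c01 in \<open>auto simp: o_assoc permutes_inv_o intro: permutes_compose permutes_inv\<close>)
  also have "\<dots> = (\<Sum>\<rho> | \<rho> permutes ?T. g (?c \<circ> \<rho>))" unfolding fixed ..
  also have "\<dots> = (\<Sum>\<tau> | \<tau> permutes {..<2 * N}. g (?c \<circ> map_permutation {..<2 * N} ((+) 2) \<tau>))"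
  proof (rule sum.reindex_bij_betw[symmetric])
    have b: "bij_betw ((+) 2) {..<2 * N} ?T"
      by (rule bij_betw_byWitness[where f' = "\<lambda>x. x - 2"]) auto
    then have im: "(+) 2 ` {..<2 * N} = ?T" by (simp add: bij_betw_def)
    show "bij_betw (map_permutation {..<2 * N} ((+) 2)) {\<tau>. \<tau> permutes {..<2 * N}} {\<rho>. \<rho> permutes ?T}"
      using bij_betw_permutations[OF b]
      unfolding map_permutation_def im restrict_id_def o_def .
  qed
  finally show ?thesis .
qed

text \<open>Symmetry puts 0 into position 0. The sum then splits by the partner \<open>Suc j\<close>
  of 0, and each class is a Pfaffian of the indices other than 0 and \<open>Suc j\<close>.\<close>

lemma pfaffian_Suc:
  fixes A :: "nat \<Rightarrow> nat \<Rightarrow> real"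
  assumes skew: "\<And>i j. A i j = - A j i"
  shows "pfaffian (Suc N) A
    = (\<Sum>j<2 * N + 1. (- 1) ^ j * A 0 (Suc j)
         * pfaffian N (\<lambda>i k. A (row_cycle j (i + 2)) (row_cycle j (k + 2))))"
proof -
  let ?S = "{..<2 * Suc N}"
  define g where "g = (\<lambda>\<sigma>. of_int (sign \<sigma>) * (\<Prod>k<Suc N. A (\<sigma> (2 * k)) (\<sigma> (2 * k + 1))))"
  \<comment> \<open>A pair-preserving permutation with \<open>h b 0 = b\<close>: for odd
    \<open>b\<close> it first exchanges 0 and 1 inside their pair, then it exchanges that pair with
    the pair containing \<open>b\<close>.\<close>
  define h where "h b = Transposition.transpose 0 (2 * (b div 2)) \<circ> Transposition.transpose 1 (2 * (b div 2) + 1)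
      \<circ> (if even b then id else Transposition.transpose 0 (1::nat))" for b
  let ?m = "map_permutation {..<2 * N} ((+) 2)"
  \<comment> \<open>The pair \<open>k = 0\<close> contributes \<open>A 0 (Suc j)\<close> and the
    cycle contributes the sign. The other pairs form the smaller Pfaffian before its
    normalisation.\<close>
  have inner: "(\<Sum>\<sigma> | \<sigma> permutes ?S \<and> \<sigma> 0 = 0 \<and> \<sigma> 1 = Suc j. g \<sigma>)
      = (- 1) ^ j * A 0 (Suc j) * (2 ^ N * fact N)
          * pfaffian N (\<lambda>i k. A (row_cycle j (i + 2)) (row_cycle j (k + 2)))"
    if j: "j < 2 * N + 1" for j
  proof -
    have "g (row_cycle j \<circ> ?m \<tau>) = (- 1) ^ j * A 0 (Suc j) * (of_int (sign \<tau>) *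
       (\<Prod>k<N. A (row_cycle j (\<tau> (2 * k) + 2)) (row_cycle j (\<tau> (2 * k + 1) + 2))))"
      if t: "\<tau> permutes {..<2 * N}" for \<tau>
    proof -
      have inj: "inj_on ((+) 2) {..<2 * N}" by simp
      have mp: "?m \<tau> permutes (+) 2 ` {..<2 * N}"
        by (rule map_permutation_permutes[OF _ t]) (simp add: bij_betw_def)
      have "permutation (?m \<tau>)" "permutation (row_cycle j)"
        using permutes_imp_permutation[OF _ mp] row_cycle_permutes[of j "Suc (Suc j)"]
          permutes_imp_permutation by (blast intro: finite_imageI finite_lessThan)+
      then have sg: "sign (row_cycle j \<circ> ?m \<tau>) = (- 1) ^ j * sign \<tau>"
        using sign_map_permutation[OF inj t] by (simp add: sign_compose sign_row_cycle)
      have m01: "?m \<tau> 0 = 0" "?m \<tau> 1 = 1" using mp by (auto intro!: permutes_not_in[OF mp])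
      have m2: "?m \<tau> (Suc (Suc i)) = \<tau> i + 2" if "i < 2 * N" for i
        using map_permutation_apply[OF inj, of i \<tau>] that by simp
      have "(\<Prod>k<N. A (row_cycle j (?m \<tau> (2 * Suc k))) (row_cycle j (?m \<tau> (2 * Suc k + 1))))
        = (\<Prod>k<N. A (row_cycle j (\<tau> (2 * k) + 2)) (row_cycle j (\<tau> (2 * k + 1) + 2)))"
        by (rule prod.cong) (auto simp: m2)
      then show ?thesis
        unfolding g_def sg prod.lessThan_Suc_shift
        using m01 by (simp add: row_cycle_apply)
    qed
    then show ?thesis
      unfolding sum_permutations_row_cycle[OF j] pfaffian_def
      by (simp add: sum_distrib_left sum_divide_distrib mult.assoc)
  qed
  have half: "2 * (b div 2) < 2 * Suc N" "2 * (b div 2) + 1 < 2 * Suc N" "b div 2 < Suc N"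
    if "b \<in> ?S" for b
    using that unfolding lessThan_iff by presburger+
  have h: "h b permutes ?S \<and> h b 0 = b" if "b \<in> ?S" for b
  proof
    show "h b permutes ?S" unfolding h_def
      using half[OF that] by (intro permutes_compose permutes_swap_id) (auto intro: permutes_id permutes_swap_id)
    show "h b 0 = b"
    proof (cases "even b")
      case True
      then show ?thesis by (auto simp: h_def Transposition.transpose_def)
    next
      case False
      then obtain m where "b = Suc (2 * m)" by (auto elim: oddE)
      then show ?thesis unfolding h_def by (simp add: Transposition.transpose_def)
    qed
  qed
  have inv: "g (\<sigma> \<circ> h b) = g \<sigma>" if b: "b \<in> ?S" and s: "\<sigma> permutes ?S" for b \<sigma>
  proof -
    let ?t = "Transposition.transpose 0 (2 * (b div 2)) \<circ> Transposition.transpose 1 (2 * (b div 2) + 1)"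
    have t: "?t permutes ?S" using half[OF b] by (intro permutes_compose permutes_swap_id) auto
    have 1: "g (\<sigma> \<circ> ?t) = g \<sigma>"
      using pfaffian_summand_block_swap[OF s half(3)[OF b], of A] unfolding g_def .
    have 2: "g ((\<sigma> \<circ> ?t) \<circ> Transposition.transpose 0 1) = g (\<sigma> \<circ> ?t)"
      using pfaffian_summand_pair_swap[where A = A, OF permutes_compose[OF t s] skew] unfolding g_def .
    show ?thesis unfolding h_def using 1 2 by (auto simp: o_assoc)
  qed
  have "(\<Sum>\<sigma> | \<sigma> permutes ?S. g \<sigma>) = card ?S * (\<Sum>\<sigma> | \<sigma> permutes ?S \<and> \<sigma> 0 = 0. g \<sigma>)"
    
  proof (rule sum_permutations_fix_value[where h = h])
    show "finite ?S" "0 \<in> ?S" by simp_all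
  qed (fact h inv)+
  \<comment> \<open>The subtraction in \<open>\<sigma> 1 - 1\<close> does not truncate, since
    \<open>\<sigma> 0 = 0\<close> and injectivity force \<open>\<sigma> 1\<close> to be
    positive.\<close>
  also have "(\<Sum>\<sigma> | \<sigma> permutes ?S \<and> \<sigma> 0 = 0. g \<sigma>)
      = (\<Sum>j<2 * N + 1. \<Sum>\<sigma>\<in>{\<sigma> \<in> {\<sigma>. \<sigma> permutes ?S \<and> \<sigma> 0 = 0}. \<sigma> 1 - 1 = j}. g \<sigma>)"
  proof (rule sum.group[symmetric])
    have "\<sigma> 1 - 1 < 2 * N + 1" if "\<sigma> permutes ?S" for \<sigma>
      using permutes_in_image[OF that, of 1] by auto
    then show "(\<lambda>\<sigma>. \<sigma> 1 - 1) ` {\<sigma>. \<sigma> permutes ?S \<and> \<sigma> 0 = 0} \<subseteq> {..<2 * N + 1}"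
      by blast
  qed (auto simp: finite_permutations)
  also have "\<dots> = (\<Sum>j<2 * N + 1. \<Sum>\<sigma> | \<sigma> permutes ?S \<and> \<sigma> 0 = 0 \<and> \<sigma> 1 = Suc j. g \<sigma>)"
  proof (rule sum.cong[OF refl])
    fix j
    have "\<sigma> 1 - 1 = j \<longleftrightarrow> \<sigma> 1 = Suc j" if "\<sigma> permutes ?S" "\<sigma> 0 = 0" for \<sigma>
      using inj_eq[OF permutes_inj[OF that(1)], of 1 0] that(2) by auto
    then have "{\<sigma> \<in> {\<sigma>. \<sigma> permutes ?S \<and> \<sigma> 0 = 0}. \<sigma> 1 - 1 = j}
        = {\<sigma>. \<sigma> permutes ?S \<and> \<sigma> 0 = 0 \<and> \<sigma> 1 = Suc j}" by blast
    then show "(\<Sum>\<sigma>\<in>{\<sigma> \<in> {\<sigma>. \<sigma> permutes ?S \<and> \<sigma> 0 = 0}. \<sigma> 1 - 1 = j}. g \<sigma>)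
        = (\<Sum>\<sigma> | \<sigma> permutes ?S \<and> \<sigma> 0 = 0 \<and> \<sigma> 1 = Suc j. g \<sigma>)" by simp
  qed
  also have "\<dots> = (2 ^ N * fact N) * (\<Sum>j<2 * N + 1. (- 1) ^ j * A 0 (Suc j)
         * pfaffian N (\<lambda>i k. A (row_cycle j (i + 2)) (row_cycle j (k + 2))))"
    unfolding sum_distrib_left
  proof (rule sum.cong[OF refl])
    fix j assume "j \<in> {..<2 * N + 1}"
    then have "j < 2 * N + 1" by simp
    from inner[OF this] show "(\<Sum>\<sigma> | \<sigma> permutes ?S \<and> \<sigma> 0 = 0 \<and> \<sigma> 1 = Suc j. g \<sigma>)
      = (2 ^ N * fact N) * ((- 1) ^ j * A 0 (Suc j)
         * pfaffian N (\<lambda>i k. A (row_cycle j (i + 2)) (row_cycle j (k + 2))))"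
      by (simp only: mult.assoc mult.left_commute)
  qed
  finally have *: "(\<Sum>\<sigma> | \<sigma> permutes ?S. g \<sigma>) = real (card ?S) * ((2 ^ N * fact N) *
      (\<Sum>j<2 * N + 1. (- 1) ^ j * A 0 (Suc j)
         * pfaffian N (\<lambda>i k. A (row_cycle j (i + 2)) (row_cycle j (k + 2)))))" .
  \<comment> \<open>The \<open>2 * Suc N\<close> possible positions of 0 supply exactly the factor
    between the two normalisations.\<close>
  have "real (card ?S) * (2 ^ N * fact N) = 2 ^ Suc N * fact (Suc N)"
    by (simp add: algebra_simps)
  then have "(\<Sum>\<sigma> | \<sigma> permutes ?S. g \<sigma>) = (2 ^ Suc N * fact (Suc N)) *
      (\<Sum>j<2 * N + 1. (- 1) ^ j * A 0 (Suc j)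
         * pfaffian N (\<lambda>i k. A (row_cycle j (i + 2)) (row_cycle j (k + 2))))"
    using * by (simp only: mult.assoc[symmetric])
  moreover have "(2 ^ Suc N * fact (Suc N) :: real) \<noteq> 0" by simp
  ultimately show ?thesis
    unfolding pfaffian_def[of "Suc N"] g_def by (simp only: nonzero_mult_div_cancel_left not_False_eq_True)
qed

section \<open>Pfaffians of lists, by recursion along the first row\<close>

definition delete_nth :: "nat \<Rightarrow> 'a list \<Rightarrow> 'a list" where
  "delete_nth j xs = take j xs @ drop (Suc j) xs"

lemma length_delete_nth: "j < length xs \<Longrightarrow> length (delete_nth j xs) = length xs - 1"
  by (simp add: delete_nth_def)

lemma length_delete_nth_le: "length (delete_nth j xs) \<le> length xs"
  by (simp add: delete_nth_def)

lemma delete_nth_Cons_0 [simp]: "delete_nth 0 (x # xs) = xs"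
  by (simp add: delete_nth_def)

lemma delete_nth_Cons_Suc [simp]: "delete_nth (Suc j) (x # xs) = x # delete_nth j xs"
  by (simp add: delete_nth_def)

lemma nth_delete_nth:
  "j < length xs \<Longrightarrow> delete_nth j xs ! i = xs ! (if i < j then i else Suc i)"
  by (auto simp: delete_nth_def nth_append)

lemma set_delete_nth: "set (delete_nth j xs) \<subseteq> set xs"
  by (auto simp: delete_nth_def dest: in_set_takeD in_set_dropD)

text \<open>With the first-row expansion as definition, later arguments become inductions on lists
  instead of manipulations of permutation sums. Lists of odd length get the value 0, see
  \<open>pf_odd\<close>.\<close>

function pf :: "('a \<Rightarrow> 'a \<Rightarrow> real) \<Rightarrow> 'a list \<Rightarrow> real" where
  "pf E [] = 1"
| "pf E (a # xs) = (\<Sum>j<length xs. (- 1) ^ j * E a (xs ! j) * pf E (delete_nth j xs))"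
  by pat_completeness auto
termination
  by (relation "Wellfounded.measure (\<lambda>(E, xs). length xs)") (auto simp: le_imp_less_Suc length_delete_nth_le)

definition skew :: "('a \<Rightarrow> 'a \<Rightarrow> real) \<Rightarrow> bool" where
  "skew E \<longleftrightarrow> (\<forall>a b. E a b = - E b a)"

lemma skewD: "skew E \<Longrightarrow> E a b = - E b a"
  unfolding skew_def by blast

lemma pf_odd: "odd (length xs) \<Longrightarrow> pf E xs = 0"
proof (induction E xs rule: pf.induct)
  case (2 E a xs)
  have "pf E (delete_nth j xs) = 0" if "j < length xs" for j
    using 2 that by (cases "xs = []") (auto simp: length_delete_nth)
  then show ?case by (auto intro!: sum.neutral)
qed simp

text \<open>From position 2 on, the cycle \<open>row_cycle j\<close> enumerates the symbols of
  \<open>delete_nth j xs\<close> in order, so \<open>pfaffian_Suc\<close> becomes the recursion of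
  \<open>pf\<close>.\<close>

lemma hirota_Pf_eq_pf:
  assumes "skew E" "even (length xs)"
  shows "hirota_Pf E xs = pf E xs"
  using assms
proof (induction E xs rule: pf.induct)
  case (1 E)
  have "{\<sigma>. \<sigma> = id} = {id :: nat \<Rightarrow> nat}" by auto
  then show ?case by (simp add: hirota_Pf_def pfaffian_def)
next
  case (2 E a xs)
  then obtain N where N: "length xs = 2 * N + 1" by (auto elim: oddE)
  have "hirota_Pf E (a # xs) = pfaffian (Suc N) (\<lambda>i j. E ((a # xs) ! i) ((a # xs) ! j))"
    by (simp add: hirota_Pf_def N)
  also have "\<dots> = (\<Sum>j<2 * N + 1. (- 1) ^ j * E a (xs ! j) * pfaffian N (\<lambda>i k.
      E ((a # xs) ! row_cycle j (i + 2)) ((a # xs) ! row_cycle j (k + 2))))"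
    by (subst pfaffian_Suc) (rule skewD[OF 2(2)], simp add: row_cycle_apply)
  also have "\<dots> = (\<Sum>j<2 * N + 1. (- 1) ^ j * E a (xs ! j) * pf E (delete_nth j xs))"
  proof (rule sum.cong[OF refl])
    fix j assume "j \<in> {..<2 * N + 1}"
    then have j: "j < length xs" using N by simp
    have len: "length (delete_nth j xs) = 2 * N" using j N by (simp add: length_delete_nth)
    have "(a # xs) ! row_cycle j (i + 2) = delete_nth j xs ! i" for i
      using j by (auto simp: row_cycle_apply nth_delete_nth nth_Cons')
    then have "pfaffian N (\<lambda>i k. E ((a # xs) ! row_cycle j (i + 2)) ((a # xs) ! row_cycle j (k + 2)))
        = hirota_Pf E (delete_nth j xs)"
      using len by (simp add: hirota_Pf_def)
    also have "\<dots> = pf E (delete_nth j xs)"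
      using 2 j len by simp
    finally show "(- 1) ^ j * E a (xs ! j) * pfaffian N (\<lambda>i k.
        E ((a # xs) ! row_cycle j (i + 2)) ((a # xs) ! row_cycle j (k + 2)))
      = (- 1) ^ j * E a (xs ! j) * pf E (delete_nth j xs)" by simp
  qed
  also have "\<dots> = pf E (a # xs)" by (simp add: N)
  finally show ?case .
qed

text \<open>The recursion singles out the first row and hides the antisymmetry in later symbols. For
  even length it is read off from the permutation sum through \<open>pfaffian_permute\<close>; for
  odd length both sides are 0.\<close>

lemma pf_swap:
  assumes E: "skew E"
  shows "pf E (xs @ a # b # ys) = - pf E (xs @ b # a # ys)"
proof (cases "even (length (xs @ a # b # ys))")
  case True
  define N where "N = length (xs @ a # b # ys) div 2"
  have N: "2 * N = length xs + length ys + 2" "length (xs @ b # a # ys) div 2 = N"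
    using True by (auto simp: N_def)
  let ?p = "Transposition.transpose (length xs) (Suc (length xs))"
  have p: "?p permutes {..<2 * N}" by (rule permutes_swap_id) (auto simp: N)
  have "(xs @ a # b # ys) ! i = (xs @ b # a # ys) ! ?p i" for i
    by (auto simp: Transposition.transpose_def nth_append nth_Cons' not_less le_Suc_eq)
  then have "hirota_Pf E (xs @ a # b # ys)
      = pfaffian N (\<lambda>i j. E ((xs @ b # a # ys) ! ?p i) ((xs @ b # a # ys) ! ?p j))"
    by (simp add: hirota_Pf_def N_def)
  also have "\<dots> = - hirota_Pf E (xs @ b # a # ys)"
    by (subst pfaffian_permute[OF p]) (simp add: sign_swap_id hirota_Pf_def N_def)
  finally show ?thesis using True E by (simp add: hirota_Pf_eq_pf)
next
  case False
  then show ?thesis by (simp add: pf_odd)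
qed

text \<open>Adjacent exchanges bring the two copies of \<open>a\<close> together, and exchanging
  equal neighbours shows that the value is its own negative.\<close>

lemma pf_repeat:
  assumes "skew E"
  shows "pf E (xs @ a # ys @ a # zs) = 0"
proof (induction ys arbitrary: xs)
  case Nil
  show ?case using pf_swap[OF assms, of xs a a zs] by simp
next
  case (Cons y ys)
  show ?case using pf_swap[OF assms, of xs a y "ys @ a # zs"] Cons[of "xs @ [y]"] by simp
qed

lemma pf_Cons_mem: "skew E \<Longrightarrow> a \<in> set xs \<Longrightarrow> pf E (a # xs) = 0"
  using pf_repeat[of E "[]" a] by (auto simp: in_set_conv_decomp)

lemma pf_move:
  assumes "skew E"
  shows "pf E (xs @ a # ys @ zs) = (- 1) ^ length ys * pf E (xs @ ys @ a # zs)"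
proof (induction ys arbitrary: xs)
  case (Cons y ys)
  show ?case using pf_swap[OF assms, of xs a y "ys @ zs"] Cons[of "xs @ [y]"] by simp
qed simp

section \<open>Pluecker relations\<close>

text \<open>Expanding the second factors along their first rows turns both sides into the same double sum.\<close>
lemma pf_pluecker:
  assumes "skew E"
  shows "(\<Sum>i<length xs. (- 1) ^ i * pf E (delete_nth i xs) * pf E (xs ! i # ys))
    = - (\<Sum>j<length ys. (- 1) ^ j * pf E (delete_nth j ys) * pf E (ys ! j # xs))"
proof -
  have "(\<Sum>i<length xs. (- 1) ^ i * pf E (delete_nth i xs) * pf E (xs ! i # ys))
    = (\<Sum>i<length xs. \<Sum>j<length ys. - ((- 1) ^ j * pf E (delete_nth j ys) *
        ((- 1) ^ i * E (ys ! j) (xs ! i) * pf E (delete_nth i xs))))"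
    by (auto simp: sum_distrib_left skewD[OF assms, of "xs ! _"] intro!: sum.cong)
  also have "\<dots> = - (\<Sum>j<length ys. (- 1) ^ j * pf E (delete_nth j ys) * pf E (ys ! j # xs))"
    by (subst sum.swap) (simp add: sum_distrib_left sum_negf)
  finally show ?thesis .
qed

text \<open>The Pluecker relation for the lists \<open>c # d # a # b # xs\<close> and
  \<open>xs\<close>. It serves even \<open>n\<close>, with \<open>c\<close>, \<open>d\<close> the
  symbols \<open>D0\<close>, \<open>D1\<close> and \<open>a\<close>, \<open>b\<close> two
  consecutive integers following \<open>xs\<close>.\<close>

lemma pf_bilinear_4:
  assumes E: "skew E"
  shows "pf E (xs @ [a]) * pf E (c # d # xs @ [b]) - pf E (xs @ [b]) * pf E (c # d # xs @ [a])
    = pf E (c # xs @ [a, b]) * pf E (d # xs) - pf E (c # xs) * pf E (d # xs @ [a, b])"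
proof -
  \<comment> \<open>Every term that transfers a symbol of \<open>xs\<close> contains that symbol
    twice, so only the terms of \<open>c\<close>, \<open>d\<close>, \<open>a\<close> and
    \<open>b\<close> survive.\<close>
  have "(\<Sum>j<length xs. (- 1) ^ j * pf E (delete_nth j xs) * pf E (xs ! j # c # d # a # b # xs)) = 0"
    and "(\<Sum>i<length xs. (- 1) ^ i * pf E (c # d # a # b # delete_nth i xs) * pf E (xs ! i # xs)) = 0"
    by (intro sum.neutral ballI; simp add: pf_Cons_mem[OF E] del: pf.simps)+
  then have *: "pf E (d # a # b # xs) * pf E (c # xs) - pf E (c # a # b # xs) * pf E (d # xs)
      + pf E (c # d # b # xs) * pf E (a # xs) - pf E (c # d # a # xs) * pf E (b # xs) = 0"
    using pf_pluecker[OF E, of "c # d # a # b # xs" xs]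
    by (simp add: sum.lessThan_Suc_shift del: pf.simps sum.lessThan_Suc)
  \<comment> \<open>The sign of moving one symbol across \<open>xs\<close>. It enters every product
    an even number of times and cancels.\<close>
  define r where "r = (- 1 :: real) ^ length xs"
  have rr: "r * x * (r * y) = x * y" "r * (r * x) = x" for x y :: real
    by (simp_all add: r_def flip: power_add mult.assoc)
  have 1: "pf E (e # a # b # xs) = pf E (e # xs @ [a, b])" for e
    using pf_move[OF E, of "[e, a]" b xs "[]"] pf_move[OF E, of "[e]" a xs "[b]"] rr
    by (simp add: r_def del: pf.simps)
  have 2: "pf E (c # d # e # xs) = r * pf E (c # d # xs @ [e])" for e
    using pf_move[OF E, of "[c, d]" e xs "[]"] by (simp add: r_def del: pf.simps)
  have 3: "pf E (e # xs) = r * pf E (xs @ [e])" for e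
    using pf_move[OF E, of "[]" e xs "[]"] by (simp add: r_def del: pf.simps)
  have "pf E (c # d # b # xs) * pf E (a # xs) = pf E (c # d # xs @ [b]) * pf E (xs @ [a])"
    "pf E (c # d # a # xs) * pf E (b # xs) = pf E (c # d # xs @ [a]) * pf E (xs @ [b])"
    unfolding 2 3 by (fact rr)+
  with * show ?thesis unfolding 1 by (simp only: mult.commute)
qed

text \<open>The Pluecker relation for \<open>d # a # b # xs\<close> and \<open>c # xs\<close>: the
  symbols \<open>d\<close>, \<open>a\<close>, \<open>b\<close> of the first list and
  \<open>c\<close> of the second give the four surviving products. It serves odd
  \<open>n\<close>.\<close>

lemma pf_bilinear_3:
  assumes E: "skew E"
  shows "pf E (c # xs @ [a]) * pf E (d # xs @ [b]) - pf E (c # xs @ [b]) * pf E (d # xs @ [a])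
    = pf E (xs @ [a, b]) * pf E (c # d # xs) - pf E xs * pf E (c # d # xs @ [a, b])"
proof -
  have "(\<Sum>j<length xs. (- 1) ^ j * pf E (c # delete_nth j xs) * pf E (xs ! j # d # a # b # xs)) = 0"
    and "(\<Sum>i<length xs. (- 1) ^ i * pf E (d # a # b # delete_nth i xs) * pf E (xs ! i # c # xs)) = 0"
    using E by (auto intro!: sum.neutral simp: pf_Cons_mem simp del: pf.simps)
  then have *: "pf E (a # b # xs) * pf E (d # c # xs) - pf E (d # b # xs) * pf E (a # c # xs)
      + pf E (d # a # xs) * pf E (b # c # xs) = - (pf E xs * pf E (c # d # a # b # xs))"
    using pf_pluecker[OF E, of "d # a # b # xs" "c # xs"]
    by (simp add: sum.lessThan_Suc_shift sum_negf del: pf.simps sum.lessThan_Suc)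
  define r where "r = (- 1 :: real) ^ length xs"
  have rr: "r * x * (r * y) = x * y" "r * (r * x) = x" for x y :: real
    by (simp_all add: r_def flip: power_add mult.assoc)
  have 1: "pf E (es @ a # b # xs) = pf E (es @ xs @ [a, b])" for es
    using pf_move[OF E, of "es @ [a]" b xs "[]"] pf_move[OF E, of "es" a xs "[b]"] rr
    by (simp add: r_def del: pf.simps)
  have 2: "pf E (e # f # xs) = r * pf E (e # xs @ [f])" for e f
    using pf_move[OF E, of "[e]" f xs "[]"] by (simp add: r_def del: pf.simps)
  have 3: "pf E (e # c # xs) = - pf E (c # e # xs)" for e
    using pf_swap[OF E, of "[]" e c xs] unfolding append_Nil .
  have "pf E (d # b # xs) * pf E (c # a # xs) = pf E (d # xs @ [b]) * pf E (c # xs @ [a])"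
    "pf E (d # a # xs) * pf E (c # b # xs) = pf E (d # xs @ [a]) * pf E (c # xs @ [b])"
    unfolding 2 by (fact rr)+
  moreover have "pf E (a # b # xs) = pf E (xs @ [a, b])"
    "pf E (c # d # a # b # xs) = pf E (c # d # xs @ [a, b])"
    using 1[of "[]"] 1[of "[c, d]"] by (simp_all del: pf.simps)
  ultimately show ?thesis using * unfolding 3 by algebra
qed

section \<open>Derivatives of Pfaffians\<close>

text \<open>The derivation that replaces one entry \<open>x\<close> at a time by \<open>S x\<close>, with weight \<open>w x\<close>.\<close>
fun shift_sum ::
  "('a \<Rightarrow> real) \<Rightarrow> ('a \<Rightarrow> 'a) \<Rightarrow> ('a list \<Rightarrow> real) \<Rightarrow> 'a list \<Rightarrow> real"
where
  "shift_sum w S f [] = 0"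
| "shift_sum w S f (x # xs) = w x * f (S x # xs) + shift_sum w S (\<lambda>zs. f (x # zs)) xs"

lemma shift_sum_append:
  "shift_sum w S f (xs @ ys)
     = shift_sum w S (\<lambda>zs. f (zs @ ys)) xs + shift_sum w S (\<lambda>zs. f (xs @ zs)) ys"
  by (induction xs arbitrary: f) auto

lemma shift_sum_cong:
  "(\<And>zs. length zs = length xs \<Longrightarrow> f zs = g zs) \<Longrightarrow> shift_sum w S f xs = shift_sum w S g xs"
proof (induction xs arbitrary: f g)
  case (Cons x xs)
  show ?case
    using Cons.prems Cons.IH[of "\<lambda>zs. f (x # zs)" "\<lambda>zs. g (x # zs)"] by simp
qed simp

lemma shift_sum_sum:
  "shift_sum w S (\<lambda>zs. \<Sum>j\<in>J. F j zs) xs = (\<Sum>j\<in>J. shift_sum w S (F j) xs)"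
  by (induction xs arbitrary: F) (auto simp: sum.distrib sum_distrib_left)

lemma shift_sum_mult: "shift_sum w S (\<lambda>zs. c * f zs) xs = c * shift_sum w S f xs"
  by (induction xs arbitrary: f) (auto simp: algebra_simps)

lemma shift_sum_eq_0: "(\<And>x. x \<in> set xs \<Longrightarrow> w x = 0) \<Longrightarrow> shift_sum w S f xs = 0"
  by (induction xs arbitrary: f) auto

text \<open>The Leibniz rule for one term of the expansion: the replaced symbol is either the
  \<open>j\<close>-th one, which occurs only in the entry, or one of the others, which occur only in
  the smaller Pfaffian.\<close>

lemma shift_sum_first_row_term:
  assumes j: "j < length xs"
  shows "shift_sum w S (\<lambda>zs. c * E a (zs ! j) * pf E (delete_nth j zs)) xs
    = c * (w (xs ! j) * E a (S (xs ! j)) * pf E (delete_nth j xs)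
        + E a (xs ! j) * shift_sum w S (pf E) (delete_nth j xs))"
proof -
  obtain ys x us where xs: "xs = ys @ x # us" and len: "length ys = j"
    using j id_take_nth_drop[OF j] by (metis length_take min.absorb4)
  have del: "delete_nth j (vs @ z # us') = vs @ us'" "(vs @ z # us') ! j = z"
    if "length vs = j" for vs us' :: "'a list" and z
    using that by (auto simp: delete_nth_def)
  have "shift_sum w S (\<lambda>zs. c * E a (zs ! j) * pf E (delete_nth j zs)) xs
    = shift_sum w S (\<lambda>zs. (c * E a x) * pf E (zs @ us)) ys
      + (w x * (c * E a (S x) * pf E (ys @ us))
      + shift_sum w S (\<lambda>zs. (c * E a x) * pf E (ys @ zs)) us)"
    unfolding xs shift_sum_append shift_sum.simps
    using len by (intro arg_cong2[where f = "(+)"] shift_sum_cong) (simp_all add: del del: pf.simps)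
  then show ?thesis
    unfolding xs using len
    by (simp add: del shift_sum_append shift_sum_mult algebra_simps del: pf.simps)
qed

text \<open>A derivation rule for the entries passes to all Pfaffians: differentiate the first-row
  expansion, apply the rule to the shorter lists by induction on the length, and collect the terms
  with \<open>shift_sum_first_row_term\<close>.\<close>

lemma has_real_derivative_pf:
  assumes E: "\<And>a b. ((\<lambda>x. E x a b) has_real_derivative
      (w a * E x0 (S a) b + w b * E x0 a (S b))) (at x0)"
  shows "((\<lambda>x. pf (E x) xs) has_real_derivative shift_sum w S (pf (E x0)) xs) (at x0)"
proof (induction "length xs" arbitrary: xs rule: less_induct)
  case less
  show ?case
  proof (cases xs)
    case Nil
    then show ?thesis by simp
  next
    case (Cons a ys)
    let ?d = "\<lambda>j. delete_nth j ys"
    have IH: "((\<lambda>x. pf (E x) (?d j)) has_real_derivative shift_sum w S (pf (E x0)) (?d j)) (at x0)" for j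
      using less[of "?d j"] length_delete_nth_le[of j ys] Cons by simp
    have "((\<lambda>x. pf (E x) (a # ys)) has_real_derivative
      (\<Sum>j<length ys. (- 1) ^ j * ((w a * E x0 (S a) (ys ! j) + w (ys ! j) * E x0 a (S (ys ! j)))
         * pf (E x0) (?d j) + E x0 a (ys ! j) * shift_sum w S (pf (E x0)) (?d j)))) (at x0)"
      unfolding pf.simps
      by (rule DERIV_sum) (auto intro!: derivative_eq_intros E IH simp: algebra_simps simp del: pf.simps)
    also have "(\<Sum>j<length ys. (- 1) ^ j * ((w a * E x0 (S a) (ys ! j) + w (ys ! j) * E x0 a (S (ys ! j)))
         * pf (E x0) (?d j) + E x0 a (ys ! j) * shift_sum w S (pf (E x0)) (?d j)))
      = w a * pf (E x0) (S a # ys) + (\<Sum>j<length ys.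
          shift_sum w S (\<lambda>zs. (- 1) ^ j * E x0 a (zs ! j) * pf (E x0) (delete_nth j zs)) ys)"
      by (simp add: shift_sum_first_row_term sum_distrib_left flip: sum.distrib)
        (simp add: algebra_simps)
    also have "\<dots> = shift_sum w S (pf (E x0)) (a # ys)"
      unfolding shift_sum.simps shift_sum_sum[symmetric]
      by (intro arg_cong2[where f = "(+)"] shift_sum_cong) simp_all
    finally show ?thesis using Cons by simp
  qed
qed

section \<open>Derivatives that insert or replace symbols\<close>

lemma pf_Cons_Cons_Cons:
  "pf E (a # c # d # xs) = E a c * pf E (d # xs) - E a d * pf E (c # xs)
     + (\<Sum>j<length xs. (- 1) ^ j * E a (xs ! j) * pf E (c # d # delete_nth j xs))"
  by (subst pf.simps(2)) (simp add: sum.lessThan_Suc_shift del: pf.simps sum.lessThan_Suc)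

text \<open>The assumed derivative of \<open>E x a b\<close> is \<open>Pf(c, d, a, b)\<close>
  without its term \<open>E c d * E a b\<close>, that is, the two-symbol case of the claim. In the
  induction the product rule produces the expansion of \<open>Pf(a, c, d, ...)\<close> along
  \<open>a\<close>, and moving \<open>a\<close> behind \<open>c\<close> and \<open>d\<close> costs
  two exchanges, hence no sign.\<close>

lemma has_real_derivative_pf_insert:
  assumes skew: "skew (E x0)"
    and E: "\<And>a b. a \<in> set xs \<Longrightarrow> b \<in> set xs \<Longrightarrow> ((\<lambda>x. E x a b) has_real_derivative
      (E x0 c b * E x0 d a - E x0 c a * E x0 d b)) (at x0)"
  shows "((\<lambda>x. pf (E x) xs) has_real_derivative pf (E x0) (c # d # xs) - E x0 c d * pf (E x0) xs) (at x0)"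
  using E
proof (induction "length xs" arbitrary: xs rule: less_induct)
  case less
  show ?case
  proof (cases xs)
    case Nil
    then show ?thesis by simp
  next
    case (Cons a ys)
    let ?d = "\<lambda>j. delete_nth j ys"
    have IH: "((\<lambda>x. pf (E x) (?d j)) has_real_derivative
        pf (E x0) (c # d # ?d j) - E x0 c d * pf (E x0) (?d j)) (at x0)" for j
      using less(1)[of "?d j"] less(2) length_delete_nth_le[of j ys] set_delete_nth[of j ys] Cons
      by (auto simp del: pf.simps)
    have D: "((\<lambda>x. E x a (ys ! j)) has_real_derivative
      (E x0 c (ys ! j) * E x0 d a - E x0 c a * E x0 d (ys ! j))) (at x0)" if "j < length ys" for j
      using less(2)[of a "ys ! j"] Cons that by simp
    have "((\<lambda>x. pf (E x) (a # ys)) has_real_derivative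
      (\<Sum>j<length ys. (- 1) ^ j * ((E x0 c (ys ! j) * E x0 d a - E x0 c a * E x0 d (ys ! j))
         * pf (E x0) (?d j) + E x0 a (ys ! j)
         * (pf (E x0) (c # d # ?d j) - E x0 c d * pf (E x0) (?d j))))) (at x0)"
      unfolding pf.simps(2)[of _ a]
      by (rule DERIV_sum)
        (auto intro!: derivative_eq_intros D IH simp: algebra_simps simp del: pf.simps)
    also have "(\<Sum>j<length ys. (- 1) ^ j * ((E x0 c (ys ! j) * E x0 d a - E x0 c a * E x0 d (ys ! j))
         * pf (E x0) (?d j) + E x0 a (ys ! j)
         * (pf (E x0) (c # d # ?d j) - E x0 c d * pf (E x0) (?d j))))
      = E x0 d a * pf (E x0) (c # ys) - E x0 c a * pf (E x0) (d # ys)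
        + (\<Sum>j<length ys. (- 1) ^ j * E x0 a (ys ! j) * pf (E x0) (c # d # ?d j))
        - E x0 c d * pf (E x0) (a # ys)"
      unfolding pf.simps(2)[of _ _ ys] sum_distrib_left sum.distrib[symmetric] sum_subtractf[symmetric]
      by (rule sum.cong) (simp_all add: algebra_simps del: pf.simps)
    also have "E x0 d a * pf (E x0) (c # ys) - E x0 c a * pf (E x0) (d # ys)
        + (\<Sum>j<length ys. (- 1) ^ j * E x0 a (ys ! j) * pf (E x0) (c # d # ?d j))
      = pf (E x0) (a # c # d # ys)"
      unfolding pf_Cons_Cons_Cons skewD[OF skew, of a] by simp
    also have "\<dots> = pf (E x0) (c # d # a # ys)"
      using pf_swap[OF skew, of "[]" a c] pf_swap[OF skew, of "[c]" a d] by (simp del: pf.simps)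
    finally show ?thesis using Cons by simp
  qed
qed

text \<open>Differentiating the row of \<open>c\<close> gives the expansion of
  \<open>Pf(d, ...)\<close>. The derivatives of the smaller Pfaffians add up to
  \<open>Pf(c, c, d, ...)\<close>, which vanishes because \<open>c\<close> is repeated.\<close>

lemma has_real_derivative_pf_replace:
  assumes skew: "skew (E x0)" and cd: "E x0 c d = 0"
    and E: "\<And>a b. a \<in> set xs \<Longrightarrow> b \<in> set xs \<Longrightarrow> ((\<lambda>x. E x a b) has_real_derivative
      (E x0 c b * E x0 d a - E x0 c a * E x0 d b)) (at x0)"
    and Ec: "\<And>a. a \<in> set xs \<Longrightarrow> ((\<lambda>x. E x c a) has_real_derivative E x0 d a) (at x0)"
  shows "((\<lambda>x. pf (E x) (c # xs)) has_real_derivative pf (E x0) (d # xs)) (at x0)"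
proof -
  let ?d = "\<lambda>j. delete_nth j xs"
  have cc: "E x0 c c = 0" using skewD[OF skew, of c c] by simp
  have D: "((\<lambda>x. pf (E x) (?d j)) has_real_derivative pf (E x0) (c # d # ?d j)) (at x0)" for j
    using has_real_derivative_pf_insert[where E = E, OF skew, of "?d j" c d] E set_delete_nth[of j xs] cd
    by (auto simp del: pf.simps)
  have "((\<lambda>x. pf (E x) (c # xs)) has_real_derivative
      (\<Sum>j<length xs. (- 1) ^ j * (E x0 d (xs ! j) * pf (E x0) (?d j)
        + E x0 c (xs ! j) * pf (E x0) (c # d # ?d j)))) (at x0)"
    unfolding pf.simps(2)[of _ c xs]
    by (rule DERIV_sum)
      (auto intro!: derivative_eq_intros Ec D simp: algebra_simps simp del: pf.simps)
  also have "(\<Sum>j<length xs. (- 1) ^ j * (E x0 d (xs ! j) * pf (E x0) (?d j)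
        + E x0 c (xs ! j) * pf (E x0) (c # d # ?d j)))
      = pf (E x0) (d # xs) + pf (E x0) (c # c # d # xs)"
    unfolding pf_Cons_Cons_Cons cc cd pf.simps(2)[of _ d xs]
    by (simp add: algebra_simps sum.distrib del: pf.simps)
  also have "pf (E x0) (c # c # d # xs) = 0" by (rule pf_Cons_mem[OF skew]) simp
  finally show ?thesis by simp
qed

text \<open>Raising any index but the last one makes it equal to its right neighbour, so a function
  vanishing on equal neighbours keeps only the last term.\<close>

lemma shift_sum_last:
  assumes "\<And>ys a zs. f (ys @ a # a # zs) = 0" "k \<le> m"
    and w: "\<And>i. w (h i) = 1" and S: "\<And>i. S (h i) = h (Suc i)"
  shows "shift_sum w S f (map h [k..<Suc m]) = f (map h [k..<m] @ [h (Suc m)])"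
  using assms(2,1)
proof (induction k arbitrary: f rule: inc_induct)
  case base
  then show ?case by (simp add: w S)
next
  case (step k)
  have "map h [k..<Suc m] = h k # map h [Suc k..<Suc m]" "map h [Suc k..<Suc m] = h (Suc k) # map h [Suc (Suc k)..<Suc m]"
    using step(2) by (auto simp: upt_conv_Cons simp del: upt_Suc)
  moreover have "f (h (Suc k) # h (Suc k) # map h [Suc (Suc k)..<Suc m]) = 0"
    using step(4)[of "[]"] by simp
  moreover have "shift_sum w S (\<lambda>zs. f (h k # zs)) (map h [Suc k..<Suc m])
      = f (h k # map h [Suc k..<m] @ [h (Suc m)])"
  proof (rule step(3))
    show "f (h k # ys @ a # a # zs) = 0" for ys a zs
      using step(4)[of "h k # ys"] by simp
  qed
  ultimately show ?case using step(2) by (simp add: w S upt_conv_Cons del: upt_Suc)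
qed

section \<open>Mixed partial derivatives\<close>

text \<open>By the mean value theorem in the first variable the second difference is
  \<open>h * (fx z (b + h) - fx z b)\<close>, which differentiability of \<open>fx\<close> at
  \<open>(a, b)\<close> compares with \<open>h\<^sup>2 * L (0, 1)\<close>.\<close>

lemma second_difference_tendsto:
  fixes f fx :: "real \<Rightarrow> real \<Rightarrow> real"
  assumes "r > 0"
    and fx: "\<And>x y. \<bar>x - a\<bar> < r \<Longrightarrow> \<bar>y - b\<bar> < r \<Longrightarrow>
      ((\<lambda>x. f x y) has_real_derivative fx x y) (at x)"
    and L: "((\<lambda>q. fx (fst q) (snd q)) has_derivative L) (at (a, b))"
  shows "((\<lambda>h. (f (a + h) (b + h) - f (a + h) b - f a (b + h) + f a b) / h\<^sup>2) \<longlongrightarrow> L (0, 1))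
    (at_right 0)"
proof (rule tendstoI)
  fix e :: real assume "e > 0"
  interpret L: bounded_linear L using L by (rule has_derivative_bounded_linear)
  \<comment> \<open>Both points used below lie within \<open>2 * h\<close> of \<open>(a, b)\<close>,
    whence the bound \<open>d / 2\<close> on \<open>h\<close>. Each then has error at most
    \<open>e / 4 * h\<close>, and the two together stay below \<open>e * h\<close>.\<close>
  obtain d where "d > 0" and d: "\<And>q. norm (q - (a, b)) < d \<Longrightarrow>
      norm (fx (fst q) (snd q) - fx a b - L (q - (a, b))) \<le> e / 8 * norm (q - (a, b))"
    using L \<open>e > 0\<close> unfolding has_derivative_at_alt
    by (metis (no_types, lifting) divide_pos_pos fst_conv snd_conv zero_less_numeral)
  have "\<forall>\<^sub>F h in at_right (0::real). 0 < h \<and> h < min (d / 2) r"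
    using eventually_at_right_real[of 0 "min (d / 2) r"] \<open>d > 0\<close> \<open>r > 0\<close> by simp
  then show "\<forall>\<^sub>F h in at_right 0.
      dist ((f (a + h) (b + h) - f (a + h) b - f a (b + h) + f a b) / h\<^sup>2) (L (0, 1)) < e"
  proof eventually_elim
    case (elim h)
    have "\<exists>z. a < z \<and> z < a + h \<and> (f (a + h) (b + h) - f (a + h) b) - (f a (b + h) - f a b)
        = (a + h - a) * (fx z (b + h) - fx z b)"
      by (rule MVT2) (use elim in \<open>auto intro!: DERIV_diff fx\<close>)
    then obtain z where z: "a < z" "z < a + h"
      and eq: "f (a + h) (b + h) - f (a + h) b - f a (b + h) + f a b = h * (fx z (b + h) - fx z b)"
      by (auto simp: algebra_simps)
    have near: "\<bar>fx z (b + k) - fx a b - L (z - a, k)\<bar> \<le> e / 4 * h" if "k = 0 \<or> k = h" for k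
    proof -
      have "norm (z - a, k) \<le> \<bar>z - a\<bar> + \<bar>k\<bar>"
        using norm_Pair_le[of "z - a" k] by simp
      also have "\<dots> \<le> 2 * h" using z that elim by auto
      finally have n: "norm (z - a, k) \<le> 2 * h" .
      then have "\<bar>fx z (b + k) - fx a b - L (z - a, k)\<bar> \<le> e / 8 * norm (z - a, k)"
        using d[of "(z, b + k)"] elim by simp
      also have "\<dots> \<le> e / 8 * (2 * h)"
        using n \<open>e > 0\<close> by (intro mult_left_mono) auto
      finally show ?thesis by simp
    qed
    have "L (z - a, h) - L (z - a, 0) = L (h *\<^sub>R (0, 1))"
      unfolding L.diff[symmetric] by simp
    then have "L (z - a, h) - L (z - a, 0) = h * L (0, 1)"
      unfolding L.scaleR by simp
    then have "\<bar>(fx z (b + h) - fx z b) - h * L (0, 1)\<bar> \<le> e / 2 * h"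
      using near[of 0, simplified add_0_right] near[of h] unfolding abs_le_iff by simp
    also have "\<dots> < e * h" using elim \<open>e > 0\<close> by simp
    finally have "\<bar>(fx z (b + h) - fx z b) - h * L (0, 1)\<bar> / h < e"
      using elim by (simp add: divide_less_eq)
    also have "\<bar>(fx z (b + h) - fx z b) - h * L (0, 1)\<bar> / h
        = \<bar>((fx z (b + h) - fx z b) - h * L (0, 1)) / h\<bar>"
      using elim by simp
    also have "((fx z (b + h) - fx z b) - h * L (0, 1)) / h
        = h * (fx z (b + h) - fx z b) / h\<^sup>2 - L (0, 1)"
      using elim by (simp add: field_simps power2_eq_square)
    finally show ?case unfolding eq dist_real_def .
  qed
qed

text \<open>The second difference is symmetric in the two variables. Its limit is therefore both the
  \<open>y\<close>-derivative of \<open>fx\<close> and the \<open>x\<close>-derivative of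
  \<open>fy\<close>.\<close>

lemma mixed_partials_eq:
  fixes f :: "real \<times> real \<Rightarrow> real"
  assumes U: "open U" "(a, b) \<in> U"
    and fx: "\<And>x y. (x, y) \<in> U \<Longrightarrow> ((\<lambda>x. f (x, y)) has_real_derivative fx (x, y)) (at x)"
    and fy: "\<And>x y. (x, y) \<in> U \<Longrightarrow> ((\<lambda>y. f (x, y)) has_real_derivative fy (x, y)) (at y)"
    and L: "(fx has_derivative L) (at (a, b))" and M: "(fy has_derivative M) (at (a, b))"
  shows "L (0, 1) = M (1, 0)"
proof -
  obtain A B where AB: "open A" "open B" "a \<in> A" "b \<in> B" "A \<times> B \<subseteq> U"
    by (rule open_prod_elim[OF U]) auto
  obtain r1 r2 where "r1 > 0" "r2 > 0" "ball a r1 \<subseteq> A" "ball b r2 \<subseteq> B"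
    using AB by (meson open_contains_ball)
  then have r: "min r1 r2 > 0" "\<And>x y. \<bar>x - a\<bar> < min r1 r2 \<Longrightarrow> \<bar>y - b\<bar> < min r1 r2 \<Longrightarrow> (x, y) \<in> U"
    using AB(5) by (auto simp: subset_iff dist_real_def abs_minus_commute)
  \<comment> \<open>Coordinates are exchanged so that \<open>second_difference_tendsto\<close> also
    applies with the roles of the variables reversed.\<close>
  have "((\<lambda>q::real \<times> real. (snd q, fst q)) has_derivative (\<lambda>q. (snd q, fst q))) (at (b, a))"
    by (auto intro!: derivative_eq_intros)
  from has_derivative_compose[OF this, of fy M] M
  have M': "((\<lambda>q. fy (snd q, fst q)) has_derivative (\<lambda>q. M (snd q, fst q))) (at (b, a))"
    by simp
  let ?\<Delta> = "\<lambda>h. (f (a + h, b + h) - f (a + h, b) - f (a, b + h) + f (a, b)) / h\<^sup>2"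
  have "(?\<Delta> \<longlongrightarrow> L (0, 1)) (at_right 0)"
    by (rule second_difference_tendsto[OF r(1), of a b "\<lambda>x y. f (x, y)" "\<lambda>x y. fx (x, y)"])
      (use fx r(2) L in auto)
  moreover have "(?\<Delta> \<longlongrightarrow> M (1, 0)) (at_right 0)"
    using second_difference_tendsto[OF r(1), of b a "\<lambda>y x. f (x, y)" "\<lambda>y x. fy (x, y)", OF _ M'] fy r(2)
    by (simp add: algebra_simps)
  ultimately show ?thesis
    using tendsto_unique trivial_limit_at_right_real by blast
qed

section \<open>Partial derivatives of smooth functions\<close>

lemma has_derivative_imp_partials:
  fixes f :: "real \<times> real \<Rightarrow> real"
  assumes "(f has_derivative L) (at (x, y))"
  shows "((\<lambda>x. f (x, y)) has_real_derivative L (1, 0)) (at x)"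
    and "((\<lambda>y. f (x, y)) has_real_derivative L (0, 1)) (at y)"
proof -
  interpret bounded_linear L using assms by (rule has_derivative_bounded_linear)
  have "((\<lambda>x. (x, y)) has_derivative (\<lambda>h. (h, 0))) (at x)"
    and "((\<lambda>y. (x, y)) has_derivative (\<lambda>h. (0, h))) (at y)"
    by (auto intro!: derivative_eq_intros)
  from this[THEN has_derivative_compose, OF assms]
  have D: "((\<lambda>x. f (x, y)) has_derivative (\<lambda>h. L (h, 0))) (at x)"
    "((\<lambda>y. f (x, y)) has_derivative (\<lambda>h. L (0, h))) (at y)" .
  have lin: "h * L (1, 0) = L (h, 0)" "h * L (0, 1) = L (0, h)" for h
    using scaleR[of h "(1, 0)"] scaleR[of h "(0, 1)"] by simp_all
  show "((\<lambda>x. f (x, y)) has_real_derivative L (1, 0)) (at x)"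
    by (rule has_derivative_imp_has_field_derivative[OF D(1) lin(1)])
  show "((\<lambda>y. f (x, y)) has_real_derivative L (0, 1)) (at y)"
    by (rule has_derivative_imp_has_field_derivative[OF D(2) lin(2)])
qed

lemma smooth_on_imp_differentiable:
  assumes "smooth_on S f" "x \<in> S"
  shows "f differentiable (at x)" and "(\<lambda>x. frechet_derivative f (at x) v) differentiable (at x)"
proof -
  have "k_smooth_on (Suc (Suc 0)) S f" using assms(1) unfolding smooth_on_def by blast
  with assms(2) show "f differentiable (at x)"
    and "(\<lambda>x. frechet_derivative f (at x) v) differentiable (at x)" by auto
qed

lemma smooth_on_has_partial_s:
  assumes "smooth_on U f" "(x, y) \<in> U"
  shows "((\<lambda>y. f (x, y)) has_real_derivative partial_s f (x, y)) (at y)"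
    and "partial_s f (x, y) = frechet_derivative f (at (x, y)) (0, 1)"
proof -
  have D: "((\<lambda>y. f (x, y)) has_real_derivative frechet_derivative f (at (x, y)) (0, 1)) (at y)"
    using has_derivative_imp_partials(2) smooth_on_imp_differentiable(1)[OF assms]
      frechet_derivative_works by blast
  then show "partial_s f (x, y) = frechet_derivative f (at (x, y)) (0, 1)"
    unfolding partial_s_def by (simp add: DERIV_imp_deriv)
  with D show "((\<lambda>y. f (x, y)) has_real_derivative partial_s f (x, y)) (at y)" by simp
qed

text \<open>Slices of an open set are open, so identities valid only on \<open>U\<close>, such as
  those between tau functions and \<open>pf\<close>, may be used under a partial derivative.\<close>

lemma has_real_derivative_transform_slice:
  fixes f g :: "real \<times> real \<Rightarrow> real"
  assumes "open U" "(t, s) \<in> U" "\<And>q. q \<in> U \<Longrightarrow> f q = g q"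
  shows "((\<lambda>x. f (x, s)) has_real_derivative D) (at t) \<Longrightarrow>
      ((\<lambda>x. g (x, s)) has_real_derivative D) (at t)"
    and "((\<lambda>y. f (t, y)) has_real_derivative D) (at s) \<Longrightarrow>
      ((\<lambda>y. g (t, y)) has_real_derivative D) (at s)"
proof -
  have "open ((\<lambda>x. (x, s)) -` U)" "open ((\<lambda>y. (t, y)) -` U)"
    using assms(1) by (simp_all add: open_vimage continuous_on_Pair)
  then show "((\<lambda>x. f (x, s)) has_real_derivative D) (at t) \<Longrightarrow>
      ((\<lambda>x. g (x, s)) has_real_derivative D) (at t)"
    and "((\<lambda>y. f (t, y)) has_real_derivative D) (at s) \<Longrightarrow>
      ((\<lambda>y. g (t, y)) has_real_derivative D) (at s)"
    using has_field_derivative_transform_within_open[of "\<lambda>x. f (x, s)" D t _ "\<lambda>x. g (x, s)"]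
      has_field_derivative_transform_within_open[of "\<lambda>y. f (t, y)" D s _ "\<lambda>y. g (t, y)"]
      assms(2,3) by (metis vimage_eq)+
qed

text \<open>Supplies the \<open>t\<close>-rule of the entries \<open>Pf(d_1, i)\<close> from that of
  \<open>Pf(d_0, i)\<close>. On \<open>U\<close> the function \<open>partial_s f\<close> is the
  Frechet derivative in direction \<open>(0, 1)\<close>, to which \<open>mixed_partials_eq\<close>
  applies.\<close>

lemma has_real_derivative_partial_s:
  assumes U: "open U" "(t, s) \<in> U" and f: "smooth_on U f" and g: "smooth_on U g"
    and fg: "\<And>x y. (x, y) \<in> U \<Longrightarrow> ((\<lambda>x. f (x, y)) has_real_derivative g (x, y)) (at x)"
  shows "((\<lambda>x. partial_s f (x, s)) has_real_derivative partial_s g (t, s)) (at t)"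
proof -
  let ?F = "\<lambda>q. frechet_derivative f (at q) (0, 1)"
  have F: "(?F has_derivative frechet_derivative ?F (at (t, s))) (at (t, s))"
    and G: "(g has_derivative frechet_derivative g (at (t, s))) (at (t, s))"
    using smooth_on_imp_differentiable[OF f U(2)] smooth_on_imp_differentiable[OF g U(2)]
      frechet_derivative_works by blast+
  have "frechet_derivative g (at (t, s)) (0, 1) = frechet_derivative ?F (at (t, s)) (1, 0)"
    by (rule mixed_partials_eq[OF U fg _ G F])
      (use smooth_on_has_partial_s[OF f] in \<open>auto\<close>)
  then have "((\<lambda>x. ?F (x, s)) has_real_derivative partial_s g (t, s)) (at t)"
    using has_derivative_imp_partials(1)[OF F] smooth_on_has_partial_s(2)[OF g U(2)] by simp
  then show ?thesis
    by (rule has_real_derivative_transform_slice(1)[OF U, rotated])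
      (use smooth_on_has_partial_s(2)[OF f] in auto)
qed

section \<open>The BKP system\<close>

text \<open>Weight and shift put the \<open>t\<close>-rules of all kinds of entries into the single
  form required by \<open>has_real_derivative_pf\<close>: integers are raised, while
  \<open>D0\<close> and \<open>D1\<close> are inert.\<close>

fun symb_weight :: "symb \<Rightarrow> real" where
  "symb_weight (Ix i) = 1"
| "symb_weight _ = 0"

fun symb_shift :: "symb \<Rightarrow> symb" where
  "symb_shift (Ix i) = Ix (Suc i)"
| "symb_shift c = c"

definition tau_symbs :: "nat \<Rightarrow> symb list" where
  "tau_symbs n = (if even n then map Ix [0..<n] else D0 # map Ix [0..<n])"

text \<open>The symbols of the \<open>s\<close>-derivative of the tau function: for even
  \<open>n\<close> the pair \<open>D0\<close>, \<open>D1\<close> is inserted, for odd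
  \<open>n\<close> the leading \<open>D0\<close> turns into \<open>D1\<close>.\<close>

definition tau_s_symbs :: "nat \<Rightarrow> symb list" where
  "tau_s_symbs n = (if even n then D0 # D1 # map Ix [0..<n] else D1 # map Ix [0..<n])"

locale bkp_system =
  fixes U :: "(real \<times> real) set"
    and \<mu> :: "nat \<Rightarrow> nat \<Rightarrow> real \<times> real \<Rightarrow> real"
    and \<beta> :: "nat \<Rightarrow> real \<times> real \<Rightarrow> real"
  assumes U: "open U"
    and smooth_\<beta>: "\<And>i. smooth_on U (\<beta> i)"
    and skew_\<mu>: "\<And>i j p. p \<in> U \<Longrightarrow> \<mu> i j p = - \<mu> j i p"
    and \<beta>_t: "\<And>i t s. (t, s) \<in> U \<Longrightarrow>
      ((\<lambda>x. \<beta> i (x, s)) has_real_derivative \<beta> (i + 1) (t, s)) (at t)"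
    and \<mu>_t: "\<And>i j t s. (t, s) \<in> U \<Longrightarrow>
      ((\<lambda>x. \<mu> i j (x, s)) has_real_derivative \<mu> (i + 1) j (t, s) + \<mu> i (j + 1) (t, s)) (at t)"
    and \<mu>_s: "\<And>i j t s. (t, s) \<in> U \<Longrightarrow>
      ((\<lambda>y. \<mu> i j (t, y)) has_real_derivative bkp_Pf \<mu> \<beta> (t, s) [D0, D1, Ix i, Ix j]) (at s)"
    and tau_nonzero: "\<And>n p. p \<in> U \<Longrightarrow> tau \<mu> \<beta> n p \<noteq> 0"
begin

abbreviation "E \<equiv> bkp_entry \<mu> \<beta>"
abbreviation "T \<equiv> tau \<mu> \<beta>"

lemma skew_E: "skew (E p)" if "p \<in> U"
  unfolding skew_def
proof (intro allI)
  show "E p a b = - E p b a" for a b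
  proof (cases "\<exists>i j. a = Ix i \<and> b = Ix j")
    case True
    then show ?thesis using skew_\<mu>[OF that] by (metis bkp_entry.simps(1))
  next
    case False
    then show ?thesis by (cases a; cases b) auto
  qed
qed

lemma tau_eq_pf: "T n p = pf (E p) (tau_symbs n)" if "p \<in> U"
  unfolding tau_def tau_symbs_def using hirota_Pf_eq_pf[OF skew_E[OF that]] by simp

lemma E_t:
  assumes p: "(t, s) \<in> U"
  shows "((\<lambda>x. E (x, s) a b) has_real_derivative
    (symb_weight a * E (t, s) (symb_shift a) b + symb_weight b * E (t, s) a (symb_shift b))) (at t)"
proof -
  have \<beta>: "((\<lambda>x. \<beta> i (x, s)) has_real_derivative \<beta> (Suc i) (t, s)) (at t)" for i
    using \<beta>_t[OF p] by simp
  have \<mu>: "((\<lambda>x. \<mu> i j (x, s)) has_real_derivative \<mu> (Suc i) j (t, s) + \<mu> i (Suc j) (t, s)) (at t)" for i j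
    using \<mu>_t[OF p] by simp
  have \<beta>_s: "((\<lambda>x. partial_s (\<beta> i) (x, s)) has_real_derivative partial_s (\<beta> (Suc i)) (t, s)) (at t)" for i
    by (rule has_real_derivative_partial_s[OF U p smooth_\<beta> smooth_\<beta>]) (use \<beta>_t in simp)
  show ?thesis
    by (cases a; cases b) (auto intro!: derivative_eq_intros \<beta> \<mu> \<beta>_s)
qed

lemma E_s:
  assumes p: "(t, s) \<in> U"
  shows "((\<lambda>y. E (t, y) D0 (Ix i)) has_real_derivative E (t, s) D1 (Ix i)) (at s)"
    and "((\<lambda>y. E (t, y) (Ix i) (Ix j)) has_real_derivative
      E (t, s) D0 (Ix j) * E (t, s) D1 (Ix i) - E (t, s) D0 (Ix i) * E (t, s) D1 (Ix j)) (at s)"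
proof -
  show "((\<lambda>y. E (t, y) D0 (Ix i)) has_real_derivative E (t, s) D1 (Ix i)) (at s)"
    using smooth_on_has_partial_s(1)[OF smooth_\<beta> p] by simp
  have "bkp_Pf \<mu> \<beta> (t, s) [D0, D1, Ix i, Ix j] = pf (E (t, s)) [D0, D1, Ix i, Ix j]"
    by (rule hirota_Pf_eq_pf[OF skew_E[OF p]]) simp
  also have "\<dots> = E (t, s) D0 (Ix j) * E (t, s) D1 (Ix i) - E (t, s) D0 (Ix i) * E (t, s) D1 (Ix j)"
    by (simp add: sum.lessThan_Suc_shift del: sum.lessThan_Suc)
  finally show "((\<lambda>y. E (t, y) (Ix i) (Ix j)) has_real_derivative
      E (t, s) D0 (Ix j) * E (t, s) D1 (Ix i) - E (t, s) D0 (Ix i) * E (t, s) D1 (Ix j)) (at s)"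
    using \<mu>_s[OF p, of i j] by simp
qed

lemma tau_s:
  assumes p: "(t, s) \<in> U"
  shows "((\<lambda>y. T n (t, y)) has_real_derivative pf (E (t, s)) (tau_s_symbs n)) (at s)"
proof (rule has_real_derivative_transform_slice(2)[OF U p])
  show "pf (E q) (tau_symbs n) = T n q" if "q \<in> U" for q
    using tau_eq_pf[OF that] by simp
  have skew: "skew (E (t, s))" by (rule skew_E[OF p])
  show "((\<lambda>y. pf (E (t, y)) (tau_symbs n)) has_real_derivative pf (E (t, s)) (tau_s_symbs n)) (at s)"
  proof (cases "even n")
    case True
    have "((\<lambda>y. pf (E (t, y)) (map Ix [0..<n])) has_real_derivative
        pf (E (t, s)) (D0 # D1 # map Ix [0..<n]) - E (t, s) D0 D1 * pf (E (t, s)) (map Ix [0..<n])) (at s)"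
      by (rule has_real_derivative_pf_insert[where E = "\<lambda>y. E (t, y)", OF skew])
        (auto simp only: set_map intro: E_s(2)[OF p])
    with True show ?thesis by (simp add: tau_symbs_def tau_s_symbs_def del: pf.simps)
  next
    case False
    have "((\<lambda>y. pf (E (t, y)) (D0 # map Ix [0..<n])) has_real_derivative
        pf (E (t, s)) (D1 # map Ix [0..<n])) (at s)"
      by (rule has_real_derivative_pf_replace[where E = "\<lambda>y. E (t, y)", OF skew])
        (auto simp only: set_map bkp_entry.simps(7) intro: E_s[OF p])
    with False show ?thesis by (simp add: tau_symbs_def tau_s_symbs_def del: pf.simps)
  qed
qed

lemma partial_s_tau: "partial_s (T n) p = pf (E p) (tau_s_symbs n)" if "p \<in> U"
  using tau_s[of "fst p" "snd p" n] that unfolding partial_s_def by (simp add: DERIV_imp_deriv)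

text \<open>The symbols in \<open>cs\<close> have weight 0, and among the consecutive integers only
  the last can be raised without producing a repeated symbol.\<close>

lemma pf_t:
  assumes p: "(t, s) \<in> U" and cs: "set cs \<subseteq> {D0, D1}"
  shows "((\<lambda>x. pf (E (x, s)) (cs @ map Ix [0..<Suc m])) has_real_derivative
    pf (E (t, s)) (cs @ map Ix [0..<m] @ [Ix (Suc m)])) (at t)"
proof -
  have "shift_sum symb_weight symb_shift (pf (E (t, s))) (cs @ map Ix [0..<Suc m])
      = shift_sum symb_weight symb_shift (\<lambda>zs. pf (E (t, s)) (cs @ zs)) (map Ix [0..<Suc m])"
    unfolding shift_sum_append using cs by (subst shift_sum_eq_0) auto
  also have "\<dots> = pf (E (t, s)) (cs @ map Ix [0..<m] @ [Ix (Suc m)])"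
  proof (rule shift_sum_last)
    show "pf (E (t, s)) (cs @ ys @ a # a # zs) = 0" for ys a zs
      using pf_repeat[OF skew_E[OF p], of "cs @ ys" a "[]"] by simp
  qed auto
  finally show ?thesis
    using has_real_derivative_pf[where E = "\<lambda>x. E (x, s)", OF E_t[OF p], of "cs @ map Ix [0..<Suc m]"]
    by simp
qed

text \<open>With \<open>xs\<close> the integers below \<open>m\<close>, the tau function of index
  \<open>n\<close> and its \<open>s\<close>-derivative end in \<open>m\<close>, and their
  \<open>t\<close>-derivatives end in \<open>m + 1\<close> instead. Index \<open>n - 1\<close> has
  neither of these two integers and index \<open>n + 1\<close> has both, which is the pattern of the
  two bilinear identities.\<close>

lemma tau_bilinear:
  assumes p: "(t, s) \<in> U" and n: "n = Suc m"
  obtains Tt Tst where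
    "((\<lambda>x. T n (x, s)) has_real_derivative Tt) (at t)"
    "((\<lambda>x. partial_s (T n) (x, s)) has_real_derivative Tst) (at t)"
    "T n (t, s) * Tst - Tt * partial_s (T n) (t, s)
      = T (n + 1) (t, s) * partial_s (T (n - 1)) (t, s) - T (n - 1) (t, s) * partial_s (T (n + 1)) (t, s)"
proof -
  let ?xs = "map Ix [0..<m]" and ?p = "(t, s)"
  \<comment> \<open>The \<open>d\<close>-symbols in front of the integers, in the tau function and
    in its \<open>s\<close>-derivative.\<close>
  define cs where "cs = (if even n then [] else [D0])"
  define ds where "ds = (if even n then [D0, D1] else [D1])"
  have sym: "tau_symbs n = cs @ map Ix [0..<Suc m]" "tau_s_symbs n = ds @ map Ix [0..<Suc m]"
    by (simp_all add: tau_symbs_def tau_s_symbs_def cs_def ds_def n)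
  define Tt where "Tt = pf (E ?p) (cs @ ?xs @ [Ix (Suc m)])"
  define Tst where "Tst = pf (E ?p) (ds @ ?xs @ [Ix (Suc m)])"
  have "((\<lambda>x. T n (x, s)) has_real_derivative Tt) (at t)"
    by (rule has_real_derivative_transform_slice(1)[OF U p, of "\<lambda>q. pf (E q) (tau_symbs n)"])
      (simp add: tau_eq_pf, unfold sym Tt_def, rule pf_t[OF p], simp add: cs_def)
  moreover have "((\<lambda>x. partial_s (T n) (x, s)) has_real_derivative Tst) (at t)"
    by (rule has_real_derivative_transform_slice(1)[OF U p, of "\<lambda>q. pf (E q) (tau_s_symbs n)"])
      (simp add: partial_s_tau, unfold sym Tst_def, rule pf_t[OF p], simp add: ds_def)
  moreover have "T n ?p * Tst - Tt * partial_s (T n) ?p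
      = T (n + 1) ?p * partial_s (T (n - 1)) ?p - T (n - 1) ?p * partial_s (T (n + 1)) ?p"
  proof (cases "even n")
    case True
    then show ?thesis
      using pf_bilinear_4[OF skew_E[OF p], of ?xs "Ix m" D0 D1 "Ix (Suc m)"]
      unfolding tau_eq_pf[OF p] partial_s_tau[OF p] Tt_def Tst_def cs_def ds_def
      by (simp add: n tau_symbs_def tau_s_symbs_def del: pf.simps)
  next
    case False
    then show ?thesis
      using pf_bilinear_3[OF skew_E[OF p], of D0 ?xs "Ix m" D1 "Ix (Suc m)"]
      unfolding tau_eq_pf[OF p] partial_s_tau[OF p] Tt_def Tst_def cs_def ds_def
      by (simp add: n tau_symbs_def tau_s_symbs_def del: pf.simps)
  qed
  ultimately show ?thesis by (rule that)
qed

section \<open>The two Toda equations\<close>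

lemma toda_u_s:
  assumes p: "(t, s) \<in> U"
  shows "((\<lambda>y. toda_u \<mu> \<beta> n (t, y)) has_real_derivative
    toda_u \<mu> \<beta> n (t, s) *
      (toda_b \<mu> \<beta> (n + 1) (t, s) - 2 * toda_b \<mu> \<beta> n (t, s) + toda_b \<mu> \<beta> (n - 1) (t, s))) (at s)"
proof -
  have D: "((\<lambda>y. T k (t, y)) has_real_derivative partial_s (T k) (t, s)) (at s)" for k
    using tau_s[OF p] partial_s_tau[OF p] by simp
  have nz: "T k (t, s) \<noteq> 0" for k by (rule tau_nonzero[OF p])
  \<comment> \<open>The function \<open>toda_u\<close> is a product of powers of tau functions, so
    its derivative is itself times the matching combination of logarithmic derivatives.\<close>
  show ?thesis
    unfolding toda_u_def toda_b_def
    by (rule derivative_eq_intros D refl)+ (use nz in \<open>auto simp: field_simps power2_eq_square\<close>)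
qed

text \<open>The numerator in the quotient rule is the left side of \<open>tau_bilinear\<close>.
  Dividing its right side by the square of the \<open>n\<close>-th tau function gives
  \<open>toda_u\<close> times the difference of the neighbouring \<open>toda_b\<close>.\<close>

lemma toda_b_t:
  assumes p: "(t, s) \<in> U" and n: "n \<ge> 1"
  shows "((\<lambda>x. toda_b \<mu> \<beta> n (x, s)) has_real_derivative
    toda_u \<mu> \<beta> n (t, s) * (toda_b \<mu> \<beta> (n - 1) (t, s) - toda_b \<mu> \<beta> (n + 1) (t, s))) (at t)"
proof -
  have nz: "T k (t, s) \<noteq> 0" for k by (rule tau_nonzero[OF p])
  obtain m where m: "n = Suc m" using n by (cases n) auto
  obtain Tt Tst where D: "((\<lambda>x. T n (x, s)) has_real_derivative Tt) (at t)"
      "((\<lambda>x. partial_s (T n) (x, s)) has_real_derivative Tst) (at t)"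
    and eq: "T n (t, s) * Tst - Tt * partial_s (T n) (t, s)
      = T (n + 1) (t, s) * partial_s (T (n - 1)) (t, s) - T (n - 1) (t, s) * partial_s (T (n + 1)) (t, s)"
    by (rule tau_bilinear[OF p m])
  have "((\<lambda>x. toda_b \<mu> \<beta> n (x, s)) has_real_derivative
      (Tst * T n (t, s) - partial_s (T n) (t, s) * Tt) / (T n (t, s) * T n (t, s))) (at t)"
    unfolding toda_b_def by (rule DERIV_divide[OF D(2) D(1) nz])
  also have "Tst * T n (t, s) - partial_s (T n) (t, s) * Tt
      = T (n + 1) (t, s) * partial_s (T (n - 1)) (t, s) - T (n - 1) (t, s) * partial_s (T (n + 1)) (t, s)"
    using eq by (simp only: mult.commute)
  also have "\<dots> / (T n (t, s) * T n (t, s))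
      = toda_u \<mu> \<beta> n (t, s) * (toda_b \<mu> \<beta> (n - 1) (t, s) - toda_b \<mu> \<beta> (n + 1) (t, s))"
    unfolding toda_u_def toda_b_def using nz by (simp add: field_simps power2_eq_square)
  finally show ?thesis .
qed

end

theorem theorem3p14:
  fixes U :: "(real \<times> real) set"
    and \<mu> :: "nat \<Rightarrow> nat \<Rightarrow> real \<times> real \<Rightarrow> real"
    and \<beta> :: "nat \<Rightarrow> real \<times> real \<Rightarrow> real"
  assumes "open U"
    and "\<And>i j. smooth_on U (\<mu> i j)"
    and "\<And>i. smooth_on U (\<beta> i)"
    and "\<And>i j p. p \<in> U \<Longrightarrow> \<mu> i j p = - \<mu> j i p"
    and "\<And>i t s. (t, s) \<in> U \<Longrightarrow>
           ((\<lambda>x. \<beta> i (x, s)) has_real_derivative \<beta> (i + 1) (t, s)) (at t)"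
    and "\<And>i j t s. (t, s) \<in> U \<Longrightarrow>
           ((\<lambda>x. \<mu> i j (x, s)) has_real_derivative \<mu> (i + 1) j (t, s) + \<mu> i (j + 1) (t, s)) (at t)"
    and "\<And>i j t s. (t, s) \<in> U \<Longrightarrow>
           ((\<lambda>y. \<mu> i j (t, y)) has_real_derivative
              bkp_Pf \<mu> \<beta> (t, s) [D0, D1, Ix i, Ix j]) (at s)"
    and "\<And>n p. p \<in> U \<Longrightarrow> tau \<mu> \<beta> n p \<noteq> 0"
  shows "\<forall>n\<ge>1. \<forall>t s. (t, s) \<in> U \<longrightarrow>
           ((\<lambda>y. toda_u \<mu> \<beta> n (t, y)) has_real_derivative
              toda_u \<mu> \<beta> n (t, s) *
                (toda_b \<mu> \<beta> (n + 1) (t, s) - 2 * toda_b \<mu> \<beta> n (t, s) + toda_b \<mu> \<beta> (n - 1) (t, s))) (at s) \<and>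
           ((\<lambda>x. toda_b \<mu> \<beta> n (x, s)) has_real_derivative
              toda_u \<mu> \<beta> n (t, s) *
                (toda_b \<mu> \<beta> (n - 1) (t, s) - toda_b \<mu> \<beta> (n + 1) (t, s))) (at t)"
proof -
  interpret bkp_system U \<mu> \<beta>
    by unfold_locales (fact assms)+
  show ?thesis using toda_u_s toda_b_t by blast
qed

end
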